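(* Let $Q,A:[0,\tau]\to\mathbb{R}^{d\times d}$ be continuously differentiable functions such that $Q(t)$ and $A(t)$ are symmetric for all $t\in[0,\tau]$, and such that the pair $(Q(0),A(0))$ satisfies one of the following: (a) $Q(0)$ is positive definite and there is $u\in\mathbb{R}^d$ with $A(0)u\cdot u>0$; or (b) $Q(0)$ is arbitrary (symmetric) and $A(0)$ is positive definite. Then the function $g(t):=\inf_{u\in E(t)}Q(t)u\cdot u$, where $E(t):=\{u\in\mathbb{R}^d: A(t)u\cdot u=1\}$, is right differentiable at $t=0$, and there is $u^0\in X(0)$ such that $$dg(0)=\inf_{u\in X(0)}(Q'(0)+p^0A'(0))u\cdot u=(Q'(0)+p^0A'(0))u^0\cdot u^0,$$ where $(u^0,p^0)\in\mathbb{R}^d\times\mathbb{R}$ satisfies $$Q(0)u^0+p^0A(0)u^0=0,\qquad p^0=-Q(0)u^0\cdot u^0,\qquad A(0)u^0\cdot u^0=1.$$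
   Context: $X(0):=\{u\in E(0): Q(0)u\cdot u=g(0)\}$ is the set of minimisers at $t=0$. $dg(0):=\lim_{t\searrow0}(g(t)-g(0))/t$ is the right derivative at $0$. $Q'(0),A'(0)$ are the (one-sided) derivatives of $Q,A$ at $0$. The number $\tau>0$ is assumed to be sufficiently small (so that for each $t\in[0,\tau]$ the infimum $g(t)$ is finite and attained). *)

theory Defs
  imports "HOL-Analysis.Analysis"
begin

definition quad_form :: "real^'n^'n \<Rightarrow> real^'n \<Rightarrow> real" where
  "quad_form M u = (M *v u) \<bullet> u"

(* Symmetry is not part of this predicate; it is always assumed separately. *)
definition pos_definite :: "real^'n^'n \<Rightarrow> bool" where
  "pos_definite M \<longleftrightarrow> (\<forall>u. u \<noteq> 0 \<longrightarrow> quad_form M u > 0)"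

(* The derivative is taken relative to the closed interval, hence one-sided at its end points. *)
definition has_C1_derivative_on ::
    "(real \<Rightarrow> 'a::real_normed_vector) \<Rightarrow> (real \<Rightarrow> 'a) \<Rightarrow> real \<Rightarrow> real \<Rightarrow> bool" where
  "has_C1_derivative_on F F' a b \<longleftrightarrow>
     (\<forall>t\<in>{a..b}. (F has_vector_derivative F' t) (at t within {a..b})) \<and>
     continuous_on {a..b} F'"

definition E_set :: "(real \<Rightarrow> real^'n^'n) \<Rightarrow> real \<Rightarrow> (real^'n) set" where
  "E_set A t = {u. quad_form (A t) u = 1}"

(* A real infimum: meaningful only where inf_finite_attained below holds. *)
definition g_inf :: "(real \<Rightarrow> real^'n^'n) \<Rightarrow> (real \<Rightarrow> real^'n^'n) \<Rightarrow> real \<Rightarrow> real" where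
  "g_inf Q A t = (INF u\<in>E_set A t. quad_form (Q t) u)"

definition X_set :: "(real \<Rightarrow> real^'n^'n) \<Rightarrow> (real \<Rightarrow> real^'n^'n) \<Rightarrow> real \<Rightarrow> (real^'n) set" where
  "X_set Q A t = {u \<in> E_set A t. quad_form (Q t) u = g_inf Q A t}"

(* Boundedness below must be stated, since Inf of an unbounded set of reals is an
   unspecified real number; nonemptiness of E_set A t follows from that of X_set Q A t. *)
definition inf_finite_attained ::
    "(real \<Rightarrow> real^'n^'n) \<Rightarrow> (real \<Rightarrow> real^'n^'n) \<Rightarrow> real \<Rightarrow> bool" where
  "inf_finite_attained Q A t \<longleftrightarrow>
     bdd_below (quad_form (Q t) ` E_set A t) \<and> X_set Q A t \<noteq> {}"

definition has_right_derivative :: "(real \<Rightarrow> real) \<Rightarrow> real \<Rightarrow> real \<Rightarrow> bool" where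
  "has_right_derivative f D a \<longleftrightarrow> ((\<lambda>h. (f (a + h) - f a) / h) \<longlongrightarrow> D) (at_right 0)"

end

theory Submission
  imports Defs
begin

text \<open>
  Write \<open>g\<close> for the value function and \<open>p\<close> for \<open>g 0\<close>.  In both cases of the hypothesis some
  combination \<open>Q 0 + \<mu> A 0\<close> is positive definite (\<open>\<mu> = 0\<close> in the first case, \<open>\<mu>\<close> large in the
  second; see \<open>exists_positive_definite_combination\<close>), and \<open>A 0\<close> takes a positive value.  Both
  properties survive for small \<open>t\<close>.  Since on \<open>E(t)\<close> the form of \<open>Q t + \<mu> A t\<close> differs from that
  of \<open>Q t\<close> only by the constant \<open>\<mu>\<close>, the objective has bounded sublevel sets on \<open>E(t)\<close>, uniformly
  in \<open>t\<close>.  This gives the existence of minimisers (\<open>coercive_imp_attained\<close>) and their compactness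
  as \<open>t\<close> tends to \<open>0\<close> (\<open>minimizers_accumulate_in_X_set\<close>).

  The Lagrangian \<open>L(t, u) = (Q(t) - p A(t))u \<bullet> u\<close> removes the moving constraint.  For \<open>t = 0\<close> it
  is nonnegative on the whole space (\<open>Lagrangian_nonneg\<close>) and vanishes on \<open>X(0)\<close>.  A null vector of
  a positive semidefinite form lies in the kernel of its matrix, which yields the multiplier
  equation with \<open>p0 = - p\<close>.

  The derivative is found by squeezing \<open>(g t - p) / t\<close>.  Let
  \<open>M(t) = (Q(t) - Q(0)) / t - p (A(t) - A(0)) / t\<close>.  Rescaling \<open>w \<in> X(0)\<close> into \<open>E(t)\<close> gives
  the upper bound \<open>M(t)w \<bullet> w / (A(t)w \<bullet> w)\<close>; nonnegativity of \<open>L(0, u)\<close> at a minimiser \<open>u\<close> for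
  the parameter \<open>t\<close> gives the lower bound \<open>M(t)u \<bullet> u\<close>.  As the minimisers accumulate only in
  \<open>X(0)\<close> and \<open>M(t)\<close> tends to \<open>Q'(0) - p A'(0)\<close>, both bounds lead to the minimum of the form of
  that matrix over \<open>X(0)\<close> (\<open>g_inf_right_derivative\<close>).
\<close>

section \<open>Quadratic forms\<close>

lemma quad_form_add: "quad_form (M + N) u = quad_form M u + quad_form N u"
  by (simp add: quad_form_def matrix_vector_mult_add_rdistrib inner_add_left)

lemma quad_form_diff: "quad_form (M - N) u = quad_form M u - quad_form N u"
  by (simp add: quad_form_def matrix_vector_mult_diff_rdistrib inner_diff_left)

lemma quad_form_scaleR: "quad_form (k *\<^sub>R M) u = k * quad_form M u"
  by (simp add: quad_form_def flip: scaleR_matrix_vector_assoc)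

lemma quad_form_scaleR_vector: "quad_form M (k *\<^sub>R u) = k\<^sup>2 * quad_form M u"
  by (simp add: quad_form_def matrix_vector_mult_scaleR power2_eq_square)

lemmas quad_form_linear = quad_form_add quad_form_diff quad_form_scaleR

lemma norm_matrix_vector_mult_le:
  fixes M :: "real^'n^'m"
  shows "norm (M *v u) \<le> norm M * norm u"
proof -
  have "norm (M *v u) = L2_set (\<lambda>i. norm ((M *v u) $ i)) UNIV"
    by (simp add: norm_vec_def)
  also have "\<dots> \<le> L2_set (\<lambda>i. norm (M $ i) * norm u) UNIV"
    by (rule L2_set_mono) (auto simp: matrix_vector_mul_component Cauchy_Schwarz_ineq2)
  also have "\<dots> = L2_set (\<lambda>i. norm (M $ i)) UNIV * norm u"
    by (simp add: L2_set_right_distrib L2_set_left_distrib)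
  also have "\<dots> = norm M * norm u"
    by (simp add: norm_vec_def[of M])
  finally show ?thesis .
qed

lemma bounded_bilinear_matrix_vector_mult:
  "bounded_bilinear ((*v) :: real^'n^'m \<Rightarrow> real^'n \<Rightarrow> real^'m)"
proof
  show "\<exists>K. \<forall>(M :: real^'n^'m) u. norm (M *v u) \<le> norm M * norm u * K"
    by (rule exI[of _ 1]) (simp add: norm_matrix_vector_mult_le)
qed (simp_all add: algebra_simps flip: scaleR_matrix_vector_assoc)

lemma tendsto_quad_form:
  assumes "(M \<longlongrightarrow> M0) F" "(u \<longlongrightarrow> u0) F"
  shows "((\<lambda>x. quad_form (M x) (u x)) \<longlongrightarrow> quad_form M0 u0) F"
  unfolding quad_form_def
  by (intro tendsto_inner bounded_bilinear.tendsto[OF bounded_bilinear_matrix_vector_mult] assms)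

lemma continuous_on_quad_form: "continuous_on S (quad_form M)"
  unfolding continuous_on_def by (auto intro!: tendsto_quad_form tendsto_intros)

lemma abs_quad_form_le: "\<bar>quad_form M u\<bar> \<le> norm M * (norm u)\<^sup>2"
proof -
  have "\<bar>quad_form M u\<bar> \<le> norm (M *v u) * norm u"
    unfolding quad_form_def by (rule Cauchy_Schwarz_ineq2)
  also have "\<dots> \<le> norm M * norm u * norm u"
    by (intro mult_right_mono norm_matrix_vector_mult_le) auto
  finally show ?thesis by (simp add: power2_eq_square)
qed

text \<open>By homogeneity the minimum of the form over the unit sphere serves as the constant \<open>c\<close>.\<close>

lemma pos_definite_coercive:
  fixes M :: "real^'n^'n"
  assumes "pos_definite M"
  obtains c where "c > 0" "\<And>u. c * (norm u)\<^sup>2 \<le> quad_form M u"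
proof -
  let ?S = "sphere 0 1 :: (real^'n) set"
  have "?S \<noteq> {}"
    using vector_choose_size[of 1] by auto
  then obtain w where w: "w \<in> ?S" "\<And>u. u \<in> ?S \<Longrightarrow> quad_form M w \<le> quad_form M u"
    using continuous_attains_inf[OF compact_sphere _ continuous_on_quad_form] by blast
  show ?thesis
  proof
    show "quad_form M w > 0"
    proof -
      have "w \<noteq> 0"
        using w(1) by auto
      then show ?thesis
        using assms by (simp add: pos_definite_def)
    qed
    show "quad_form M w * (norm u)\<^sup>2 \<le> quad_form M u" for u
    proof (cases "u = 0")
      case True
      then show ?thesis by (simp add: quad_form_def)
    next
      case False
      define v where "v = (1 / norm u) *\<^sub>R u"
      have "u = norm u *\<^sub>R v" "v \<in> ?S"
        using False by (simp_all add: v_def)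
      then show ?thesis
        using w(2)[of v] quad_form_scaleR_vector[of M "norm u" v]
        by (metis mult.commute mult_right_mono zero_le_power2)
    qed
  qed
qed

text \<open>
  Coercivity is an open condition on the matrix.  The perturbed constant \<open>c / 2\<close> is the same for
  all nearby matrices, and this uniformity is what later bounds minimisers for all small \<open>t\<close> at once.
\<close>

lemma coercive_eventually:
  fixes B :: "real \<Rightarrow> real^'n^'n"
  assumes "(B \<longlongrightarrow> B0) F" "c > 0" "\<And>u. c * (norm u)\<^sup>2 \<le> quad_form B0 u"
  shows "\<forall>\<^sub>F t in F. \<forall>u. c / 2 * (norm u)\<^sup>2 \<le> quad_form (B t) u"
proof -
  have "\<forall>\<^sub>F t in F. dist (B t) B0 < c / 2"
    using assms(1,2) by (intro tendstoD) auto
  then show ?thesis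
  proof (rule eventually_mono, intro allI)
    fix t u assume t: "dist (B t) B0 < c / 2"
    have "\<bar>quad_form (B t - B0) u\<bar> \<le> c / 2 * (norm u)\<^sup>2"
      using abs_quad_form_le[of "B t - B0" u] t
      by (smt (verit) dist_norm mult_right_mono zero_le_power2)
    then show "c / 2 * (norm u)\<^sup>2 \<le> quad_form (B t) u"
      using assms(3)[of u] unfolding quad_form_diff by linarith
  qed
qed

text \<open>
  A null vector \<open>u\<close> minimises the form, so the form cannot decrease to first order along
  \<open>- M u\<close>.  Its first-order rate of change there is \<open>- 2 (M u \<bullet> M u)\<close>, which must therefore vanish.
\<close>

lemma semidefinite_null_vector_in_kernel:
  fixes M :: "real^'n^'n"
  assumes sym: "transpose M = M"
    and nonneg: "\<And>v. quad_form M v \<ge> 0"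
    and null: "quad_form M u = 0"
  shows "M *v u = 0"
proof -
  define w where "w = M *v u"
  define x q where "x = w \<bullet> w" and "q = quad_form M w"
  have q: "q \<ge> 0" and x: "x \<ge> 0"
    using nonneg by (simp_all add: q_def x_def)
  have swap: "(M *v w) \<bullet> u = x"
    using dot_lmul_matrix[of w M u] sym transpose_matrix_vector[of M w]
    by (simp add: x_def w_def)
  have expand: "quad_form M (u - s *\<^sub>R w) = s\<^sup>2 * q - 2 * s * x" for s
  proof -
    have "quad_form M (u - s *\<^sub>R w) = quad_form M u - s * (w \<bullet> w) - s * ((M *v w) \<bullet> u) + s\<^sup>2 * q"
      by (simp add: quad_form_def q_def matrix_vector_mult_diff_distrib matrix_vector_mult_scaleR
          inner_diff_left inner_diff_right power2_eq_square w_def[symmetric] algebra_simps)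
    then show ?thesis
      using null swap by (simp add: x_def)
  qed
  \<comment> \<open>For this step length the quadratic term is at most half of the linear one.\<close>
  define s where "s = x / (q + 1)"
  have s: "s \<ge> 0" "s * q \<le> x" "x = s * (q + 1)"
    using q x by (auto simp: s_def field_simps)
  have "2 * s * x \<le> s * (s * q)"
    using nonneg[of "u - s *\<^sub>R w"] expand[of s] by (simp add: power2_eq_square algebra_simps)
  also have "\<dots> \<le> s * x"
    using s by (intro mult_left_mono)
  finally have "s * x \<le> 0" by simp
  then have "s * s * (q + 1) \<le> 0"
    using s(3) by (metis mult.assoc)
  then have "s = 0"
    using q by (auto simp: mult_le_0_iff)
  then show ?thesis
    using s(3) by (simp add: x_def w_def)
qed

section \<open>The minimisation problem at a fixed parameter\<close>

text \<open>
  On \<open>E_set A t\<close> the term \<open>\<mu> A(t)\<close> contributes the constant \<open>\<mu>\<close>, so coercivity of the combination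
  bounds the sublevel sets of \<open>Q(t)\<close> on the constraint set, although \<open>Q(t)\<close> itself may be
  indefinite and \<open>E_set A t\<close> unbounded.
\<close>

lemma coercive_imp_attained:
  fixes Q A :: "real \<Rightarrow> real^'n^'n"
  assumes c: "c > 0" and coercive: "\<And>u. c * (norm u)\<^sup>2 \<le> quad_form (Q t + \<mu> *\<^sub>R A t) u"
    and w: "quad_form (A t) w > 0"
  shows "inf_finite_attained Q A t"
proof -
  define v where "v = (1 / sqrt (quad_form (A t) w)) *\<^sub>R w"
  have v: "v \<in> E_set A t"
    using w by (simp add: v_def E_set_def quad_form_scaleR_vector power_divide)
  have onE: "c * (norm u)\<^sup>2 \<le> quad_form (Q t) u + \<mu>" if "u \<in> E_set A t" for u
    using coercive[of u] that by (simp add: quad_form_linear E_set_def)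
  define K where "K = {u \<in> E_set A t. quad_form (Q t) u \<le> quad_form (Q t) v}"
  have "closed K"
    unfolding K_def E_set_def Collect_conj_eq[symmetric] mem_Collect_eq
    by (intro closed_Collect_conj closed_Collect_eq closed_Collect_le continuous_on_quad_form
        continuous_on_const)
  moreover have "bounded K"
    unfolding bounded_iff
  proof (intro exI ballI)
    fix u assume "u \<in> K"
    then have "c * (norm u)\<^sup>2 \<le> quad_form (Q t) v + \<mu>"
      using onE[of u] by (auto simp: K_def)
    then have "(norm u)\<^sup>2 \<le> (quad_form (Q t) v + \<mu>) / c"
      using c by (simp add: field_simps)
    then show "norm u \<le> sqrt ((quad_form (Q t) v + \<mu>) / c)"
      by (rule real_le_rsqrt)
  qed
  ultimately have "compact K"
    by (simp add: compact_eq_bounded_closed)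
  moreover have vK: "v \<in> K"
    using v by (simp add: K_def)
  ultimately obtain u0 where u0: "u0 \<in> K" "\<And>u. u \<in> K \<Longrightarrow> quad_form (Q t) u0 \<le> quad_form (Q t) u"
    using continuous_attains_inf[of K "quad_form (Q t)"] continuous_on_quad_form by blast
  have min: "quad_form (Q t) u0 \<le> quad_form (Q t) u" if "u \<in> E_set A t" for u
    using u0(2)[of u] u0(2)[OF vK] u0(1) that by (fastforce simp: K_def)
  have u0E: "u0 \<in> E_set A t"
    using u0 by (simp add: K_def)
  have "g_inf Q A t = quad_form (Q t) u0"
    unfolding g_inf_def using min u0E by (intro cInf_eq_minimum) auto
  then show ?thesis
    using u0E min by (auto simp: inf_finite_attained_def X_set_def intro!: bdd_belowI2)
qed

text \<open>
  The homogeneous form of minimality: it applies to every vector that can be rescaled into the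
  constraint set, so that one vector may be tested at all nearby parameters.
\<close>

lemma g_inf_le:
  assumes "inf_finite_attained Q A t" "quad_form (A t) u > 0"
  shows "g_inf Q A t * quad_form (A t) u \<le> quad_form (Q t) u"
proof -
  define v where "v = (1 / sqrt (quad_form (A t) u)) *\<^sub>R u"
  have "v \<in> E_set A t"
    using assms by (simp add: v_def E_set_def quad_form_scaleR_vector power_divide)
  then have "g_inf Q A t \<le> quad_form (Q t) v"
    using assms unfolding g_inf_def inf_finite_attained_def by (intro cINF_lower) auto
  also have "\<dots> = quad_form (Q t) u / quad_form (A t) u"
    using assms by (simp add: v_def quad_form_scaleR_vector power_divide)
  finally show ?thesis
    using assms by (simp add: field_simps)
qed

text \<open>
  Where \<open>A(t)\<close> is positive this is minimality.  Elsewhere it comes from the semidefinite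
  combination \<open>Q(t) + \<mu> A(t)\<close>: its value at a minimiser shows \<open>g + \<mu> \<ge> 0\<close>, hence
  \<open>Q(t) - g A(t) = (Q(t) + \<mu> A(t)) - (g + \<mu>) A(t)\<close> is nonnegative at vectors where \<open>A(t)\<close> is not
  positive.
\<close>

lemma Lagrangian_nonneg:
  assumes att: "inf_finite_attained Q A t" and nonneg: "\<And>u. quad_form (Q t + \<mu> *\<^sub>R A t) u \<ge> 0"
  shows "g_inf Q A t * quad_form (A t) u \<le> quad_form (Q t) u"
proof (cases "quad_form (A t) u > 0")
  case True
  then show ?thesis using g_inf_le att by blast
next
  case False
  obtain u0 where "u0 \<in> X_set Q A t"
    using att by (auto simp: inf_finite_attained_def)
  then have "g_inf Q A t + \<mu> \<ge> 0"
    using nonneg[of u0] by (simp add: X_set_def E_set_def quad_form_linear)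
  then have "(g_inf Q A t + \<mu>) * quad_form (A t) u \<le> 0"
    using False by (simp add: mult_nonneg_nonpos)
  then show ?thesis
    using nonneg[of u] by (simp add: quad_form_linear algebra_simps)
qed

text \<open>
  A minimiser is a null vector of the nonnegative Lagrangian form, which gives the multiplier equation
  without differentiating along the constraint.
\<close>

lemma X_set_multiplier_equation:
  assumes "inf_finite_attained Q A t" "\<And>u. quad_form (Q t + \<mu> *\<^sub>R A t) u \<ge> 0"
    and sym: "transpose (Q t) = Q t" "transpose (A t) = A t"
    and u: "u \<in> X_set Q A t"
  shows "Q t *v u - g_inf Q A t *\<^sub>R (A t *v u) = 0"
proof -
  have "(Q t - g_inf Q A t *\<^sub>R A t) *v u = 0"
  proof (rule semidefinite_null_vector_in_kernel)
    show "transpose (Q t - g_inf Q A t *\<^sub>R A t) = Q t - g_inf Q A t *\<^sub>R A t"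
      using sym by (simp add: transpose_def vec_eq_iff)
    show "quad_form (Q t - g_inf Q A t *\<^sub>R A t) v \<ge> 0" for v
      using Lagrangian_nonneg[OF assms(1,2), of v] by (simp add: quad_form_linear)
    show "quad_form (Q t - g_inf Q A t *\<^sub>R A t) u = 0"
      using u by (simp add: X_set_def E_set_def quad_form_linear)
  qed
  then show ?thesis
    by (simp add: matrix_vector_mult_diff_rdistrib scaleR_matrix_vector_assoc)
qed

lemma compact_X_set:
  fixes Q A :: "real \<Rightarrow> real^'n^'n"
  assumes c: "c > 0" and coercive: "\<And>u. c * (norm u)\<^sup>2 \<le> quad_form (Q t + \<mu> *\<^sub>R A t) u"
  shows "compact (X_set Q A t)"
proof -
  have "closed (X_set Q A t)"
    unfolding X_set_def E_set_def mem_Collect_eq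
    by (intro closed_Collect_conj closed_Collect_eq continuous_on_quad_form continuous_on_const)
  moreover have "bounded (X_set Q A t)"
    unfolding bounded_iff
  proof (intro exI ballI)
    fix u assume "u \<in> X_set Q A t"
    then have "c * (norm u)\<^sup>2 \<le> g_inf Q A t + \<mu>"
      using coercive[of u] by (auto simp: X_set_def E_set_def quad_form_linear)
    then have "(norm u)\<^sup>2 \<le> (g_inf Q A t + \<mu>) / c"
      using c by (simp add: field_simps)
    then show "norm u \<le> sqrt ((g_inf Q A t + \<mu>) / c)"
      by (rule real_le_rsqrt)
  qed
  ultimately show ?thesis
    by (simp add: compact_eq_bounded_closed)
qed

section \<open>The derivative of the value function\<close>

text \<open>
  A minimiser \<open>w\<close> for the parameter \<open>0\<close>, rescaled, competes at each small \<open>t\<close>, so the minimal values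
  are bounded by a quantity that tends to \<open>g 0\<close>.  With the uniform coercivity this bounds the
  minimisers; in the limit it also forces the value of any cluster point down to \<open>g 0\<close>.
\<close>

lemma minimizers_accumulate_in_X_set:
  fixes Q A :: "real \<Rightarrow> real^'n^'n" and u :: "nat \<Rightarrow> real^'n"
  assumes s: "filterlim s (at_right 0) sequentially"
    and Q: "(Q \<longlongrightarrow> Q 0) (at_right 0)" and A: "(A \<longlongrightarrow> A 0) (at_right 0)"
    and att: "inf_finite_attained Q A 0" "\<forall>\<^sub>F t in at_right 0. inf_finite_attained Q A t"
    and c: "c > 0"
    and coercive: "\<forall>\<^sub>F t in at_right 0. \<forall>u. c * (norm u)\<^sup>2 \<le> quad_form (Q t + \<mu> *\<^sub>R A t) u"
    and u: "\<forall>\<^sub>F n in sequentially. u n \<in> X_set Q A (s n)"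
  obtains l r where "l \<in> X_set Q A 0" "strict_mono r" "(u \<circ> r) \<longlonglongrightarrow> l"
proof -
  obtain w where w: "w \<in> X_set Q A 0"
    using att(1) by (auto simp: inf_finite_attained_def)
  have Qs: "(\<lambda>n. Q (s n)) \<longlonglongrightarrow> Q 0" and As: "(\<lambda>n. A (s n)) \<longlonglongrightarrow> A 0"
    using filterlim_compose[OF Q s] filterlim_compose[OF A s] by auto
  define b where "b = (\<lambda>n. quad_form (Q (s n)) w / quad_form (A (s n)) w)"
  have w1: "quad_form (A 0) w = 1" "quad_form (Q 0) w = g_inf Q A 0"
    using w by (auto simp: X_set_def E_set_def)
  have Aw: "(\<lambda>n. quad_form (A (s n)) w) \<longlonglongrightarrow> 1"
    using tendsto_quad_form[OF As tendsto_const, of w] w1 by simp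
  have b: "b \<longlonglongrightarrow> g_inf Q A 0"
    using tendsto_divide[OF tendsto_quad_form[OF Qs tendsto_const, of w] Aw] w1
    by (simp add: b_def)
  \<comment> \<open>Rescaling \<open>w\<close> gives a competitor for the problem at \<open>s n\<close>.\<close>
  have Qu: "\<forall>\<^sub>F n in sequentially. quad_form (Q (s n)) (u n) \<le> b n"
    using order_tendstoD(1)[OF Aw zero_less_one] u eventually_compose_filterlim[OF att(2) s]
  proof eventually_elim
    case (elim n)
    then have "g_inf Q A (s n) * quad_form (A (s n)) w \<le> quad_form (Q (s n)) w"
      by (intro g_inf_le)
    with elim show ?case
      by (simp add: X_set_def b_def pos_le_divide_eq)
  qed
  have "\<forall>\<^sub>F n in sequentially. norm (u n) \<le> sqrt ((g_inf Q A 0 + 1 + \<mu>) / c)"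
    using Qu u eventually_compose_filterlim[OF coercive s]
      order_tendstoD(2)[OF b less_add_one]
  proof eventually_elim
    case (elim n)
    then have "c * (norm (u n))\<^sup>2 \<le> g_inf Q A 0 + 1 + \<mu>"
      unfolding X_set_def E_set_def quad_form_linear by (auto dest!: spec[of _ "u n"])
    then show ?case
      using c by (intro real_le_rsqrt) (simp add: field_simps)
  qed
  then have "Bseq u"
    by (rule BfunI)
  then have "bounded (range u)"
    by (simp add: Bseq_eq_bounded)
  then obtain l r where r: "strict_mono r" and l: "(u \<circ> r) \<longlonglongrightarrow> l"
    using bounded_imp_convergent_subsequence by blast
  note sub = filterlim_compose[OF _ filterlim_subseq[OF r]] eventually_subseq[OF r]
  have lim: "(\<lambda>n. quad_form (M (s (r n))) (u (r n))) \<longlonglongrightarrow> quad_form (M 0) l"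
    if "(\<lambda>n. M (s n)) \<longlonglongrightarrow> M 0" for M
    using tendsto_quad_form[OF sub(1)[OF that] l] by (simp add: o_def)
  have "(\<lambda>n. quad_form (A (s (r n))) (u (r n))) \<longlonglongrightarrow> 1"
    by (rule tendsto_eventually, use sub(2)[OF u] in eventually_elim)
      (simp add: X_set_def E_set_def)
  then have lE: "quad_form (A 0) l = 1"
    using LIMSEQ_unique[OF lim[OF As]] by blast
  have "quad_form (Q 0) l \<le> g_inf Q A 0"
    using tendsto_le[OF _ sub(1)[OF b] lim[OF Qs] sub(2)[OF Qu]] by simp
  moreover have "g_inf Q A 0 \<le> quad_form (Q 0) l"
    using g_inf_le[OF att(1), of l] lE by simp
  ultimately have "l \<in> X_set Q A 0"
    using lE by (simp add: X_set_def E_set_def)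
  with r l show ?thesis using that by blast
qed

text \<open>
  This is Danskin's theorem for the Lagrangian: the value function inherits the smallest of the
  partial \<open>t\<close>-derivatives of \<open>(Q(t) - g(0) A(t))u \<bullet> u\<close> over the minimisers \<open>u\<close> at \<open>t = 0\<close>.
\<close>

lemma g_inf_right_derivative:
  fixes Q A :: "real \<Rightarrow> real^'n^'n" and Q1 A1 :: "real^'n^'n"
  defines "dq \<equiv> \<lambda>F t. (1 / t) *\<^sub>R (F t - F 0)"
  defines "M0 \<equiv> Q1 - g_inf Q A 0 *\<^sub>R A1"
  assumes Q: "(Q \<longlongrightarrow> Q 0) (at_right 0)" and A: "(A \<longlongrightarrow> A 0) (at_right 0)"
    and dQ: "(dq Q \<longlongrightarrow> Q1) (at_right 0)" and dA: "(dq A \<longlongrightarrow> A1) (at_right 0)"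
    and att: "inf_finite_attained Q A 0" "\<forall>\<^sub>F t in at_right 0. inf_finite_attained Q A t"
    and c: "c > 0"
    and coercive0: "\<And>u. c * (norm u)\<^sup>2 \<le> quad_form (Q 0 + \<mu> *\<^sub>R A 0) u"
    and coercive: "\<forall>\<^sub>F t in at_right 0. \<forall>u. c * (norm u)\<^sup>2 \<le> quad_form (Q t + \<mu> *\<^sub>R A t) u"
    and w: "w \<in> X_set Q A 0" "\<And>u. u \<in> X_set Q A 0 \<Longrightarrow> quad_form M0 w \<le> quad_form M0 u"
  shows "has_right_derivative (g_inf Q A) (quad_form M0 w) 0"
proof -
  define p where "p = g_inf Q A 0"
  define D where "D = quad_form M0 w"
  define quot where "quot = (\<lambda>t. (g_inf Q A t - p) / t)"
  define M where "M = (\<lambda>t. dq Q t - p *\<^sub>R dq A t)"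
  have M: "(M \<longlongrightarrow> M0) (at_right 0)"
    unfolding M_def M0_def p_def by (intro tendsto_intros dQ dA)
  have quad_M: "quad_form (M t) u =
      ((quad_form (Q t) u - p * quad_form (A t) u) - (quad_form (Q 0) u - p * quad_form (A 0) u)) / t"
    for t u
    by (simp add: M_def dq_def quad_form_linear algebra_simps diff_divide_distrib add_divide_distrib)
  have w1: "quad_form (A 0) w = 1" "quad_form (Q 0) w = p"
    using w by (auto simp: X_set_def E_set_def p_def)
  have pos: "\<forall>\<^sub>F t in at_right 0. (0::real) < t"
    by (simp add: eventually_at_right_less)

  have Aw: "((\<lambda>t. quad_form (A t) w) \<longlongrightarrow> 1) (at_right 0)"
    using tendsto_quad_form[OF A tendsto_const, of w] w1 by simp
  define upper where "upper = (\<lambda>t. quad_form (M t) w / quad_form (A t) w)"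
  have upper_lim: "(upper \<longlongrightarrow> D) (at_right 0)"
    using tendsto_divide[OF tendsto_quad_form[OF M tendsto_const, of w] Aw]
    by (simp add: upper_def D_def)
  \<comment> \<open>Test the problem at \<open>t\<close> with the fixed minimiser \<open>w\<close>.\<close>
  have upper: "\<forall>\<^sub>F t in at_right 0. quot t \<le> upper t"
    using order_tendstoD(1)[OF Aw zero_less_one] att(2) pos
  proof eventually_elim
    case (elim t)
    then have "(g_inf Q A t - p) * quad_form (A t) w \<le> quad_form (Q t) w - p * quad_form (A t) w"
      using g_inf_le[of Q A t w] by (simp add: algebra_simps)
    then show ?case
      using elim w1 by (simp add: quot_def upper_def quad_M field_simps)
  qed

  \<comment> \<open>Test the problem at \<open>0\<close> with minimisers at \<open>t\<close>, which approach \<open>X_set Q A 0\<close>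
    along a subsequence.\<close>
  have lower: "\<forall>\<^sub>F t in at_right 0. a < quot t" if "a < D" for a
  proof (rule sequentially_imp_eventually_at_right[OF zero_less_one])
    fix s :: "nat \<Rightarrow> real"
    assume s: "\<And>n. 0 < s n" "s \<longlonglongrightarrow> 0"
    then have s_right: "filterlim s (at_right 0) sequentially"
      by (intro tendsto_imp_filterlim_at_right) auto
    show "\<forall>\<^sub>F n in sequentially. a < quot (s n)"
    proof (rule ccontr)
      assume "\<not> ?thesis"
      then obtain k :: "nat \<Rightarrow> nat" where k: "strict_mono k" "\<And>n. \<not> a < quot (s (k n))"
        using not_eventually_sequentiallyD[of "\<lambda>n. a < quot (s n)"] by blast
      define t where "t = s \<circ> k"
      have t_pos: "t n > 0" and t_quot: "quot (t n) \<le> a" for n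
        using s(1) k(2)[of n] by (auto simp: t_def)
      have t: "filterlim t (at_right 0) sequentially"
        using filterlim_compose[OF s_right filterlim_subseq[OF k(1)]] by (simp add: t_def o_def)
      define u where "u = (\<lambda>n. SOME u. u \<in> X_set Q A (t n))"
      have u: "\<forall>\<^sub>F n in sequentially. u n \<in> X_set Q A (t n)"
        using eventually_compose_filterlim[OF att(2) t]
        by eventually_elim (auto simp: u_def inf_finite_attained_def some_in_eq)
      obtain l r where l: "l \<in> X_set Q A 0" and r: "strict_mono r" "(u \<circ> r) \<longlonglongrightarrow> l"
        using minimizers_accumulate_in_X_set[OF t Q A att c coercive u] .
      have "\<forall>\<^sub>F n in sequentially. quad_form (M (t n)) (u n) \<le> quot (t n)"
        using u
      proof eventually_elim
        case (elim n)
        have "p * quad_form (A 0) (u n) \<le> quad_form (Q 0) (u n)"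
          unfolding p_def
        proof (rule Lagrangian_nonneg[OF att(1)])
          show "0 \<le> quad_form (Q 0 + \<mu> *\<^sub>R A 0) v" for v
            using coercive0[of v] c by (smt (verit) mult_nonneg_nonneg zero_le_power2)
        qed
        then show ?case
          using elim t_pos[of n]
          by (simp add: quad_M quot_def X_set_def E_set_def divide_right_mono)
      qed
      then have le: "\<forall>\<^sub>F n in sequentially. quad_form (M (t (r n))) (u (r n)) \<le> a"
        by (rule eventually_subseq[OF r(1), THEN eventually_mono]) (use t_quot order_trans in blast)
      have "(\<lambda>n. M (t (r n))) \<longlonglongrightarrow> M0"
        by (rule filterlim_compose[OF filterlim_compose[OF M t] filterlim_subseq[OF r(1)]])
      then have lim: "(\<lambda>n. quad_form (M (t (r n))) (u (r n))) \<longlonglongrightarrow> quad_form M0 l"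
        using r(2) by (intro tendsto_quad_form) (auto simp: o_def)
      have "quad_form M0 l \<le> a"
        using tendsto_upperbound[OF lim le] by simp
      with w(2)[OF l] that show False by (simp add: D_def)
    qed
  qed

  have "(quot \<longlongrightarrow> D) (at_right 0)"
  proof (rule order_tendstoI)
    show "\<forall>\<^sub>F t in at_right 0. quot t < a" if "D < a" for a
      using upper order_tendstoD(2)[OF upper_lim that] by eventually_elim simp
  qed (rule lower)
  then show ?thesis
    by (simp add: has_right_derivative_def quot_def D_def p_def)
qed

lemma C1_tendsto_at_right:
  assumes "\<tau> > 0" "has_C1_derivative_on F F' 0 \<tau>"
  shows "(F \<longlongrightarrow> F 0) (at_right 0)"
    and "((\<lambda>t. (1 / t) *\<^sub>R (F t - F 0)) \<longlongrightarrow> F' 0) (at_right 0)"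
proof -
  have at: "at 0 within {0..\<tau>} = at_right 0"
    using assms(1) by (rule at_within_Icc_at_right)
  have der: "(F has_vector_derivative F' 0) (at_right 0)"
    using assms by (auto simp: has_C1_derivative_on_def simp flip: at)
  show "(F \<longlongrightarrow> F 0) (at_right 0)"
    using has_vector_derivative_continuous[OF der] by (simp add: continuous_within)
  have "((\<lambda>t. (1 / t) *\<^sub>R (F t - F 0) - F' 0) \<longlongrightarrow> 0) (at_right 0)"
  proof (rule Lim_transform_eventually)
    show "((\<lambda>t. (1 / norm (t - 0)) *\<^sub>R (F t - (F 0 + (t - 0) *\<^sub>R F' 0))) \<longlongrightarrow> 0) (at_right 0)"
      using der by (simp add: has_vector_derivative_def has_derivative_within)
    show "\<forall>\<^sub>F t in at_right 0. (1 / norm (t - 0)) *\<^sub>R (F t - (F 0 + (t - 0) *\<^sub>R F' 0))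
        = (1 / t) *\<^sub>R (F t - F 0) - F' 0"
      using eventually_at_right_less[of 0] by eventually_elim (simp add: algebra_simps)
  qed
  then show "((\<lambda>t. (1 / t) *\<^sub>R (F t - F 0)) \<longlongrightarrow> F' 0) (at_right 0)"
    by (rule LIM_zero_cancel)
qed

text \<open>
  This merges the two alternatives of the hypothesis: \<open>\<mu> = 0\<close> works if \<open>Q0\<close> is positive definite,
  and if \<open>A0\<close> is, a large multiple of it outweighs \<open>Q0\<close>.
\<close>

lemma exists_positive_definite_combination:
  fixes Q0 A0 :: "real^'n^'n"
  assumes "(pos_definite Q0 \<and> (\<exists>u. quad_form A0 u > 0)) \<or> pos_definite A0"
  obtains \<mu> w where "pos_definite (Q0 + \<mu> *\<^sub>R A0)" "quad_form A0 w > 0"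
  using assms
proof (elim disjE conjE exE)
  fix w assume "pos_definite Q0" "quad_form A0 w > 0"
  then show ?thesis using that[of 0 w] by simp
next
  assume pA: "pos_definite A0"
  obtain a where a: "a > 0" "\<And>u. a * (norm u)\<^sup>2 \<le> quad_form A0 u"
    using pos_definite_coercive[OF pA] by blast
  obtain w :: "real^'n" where "norm w = 1"
    using vector_choose_size[of 1] by auto
  then have "w \<noteq> 0"
    by auto
  define \<mu> where "\<mu> = (norm Q0 + 1) / a"
  have "quad_form (Q0 + \<mu> *\<^sub>R A0) u > 0" if "u \<noteq> 0" for u
  proof -
    have "\<mu> * (a * (norm u)\<^sup>2) \<le> \<mu> * quad_form A0 u"
      using a by (intro mult_left_mono) (auto simp: \<mu>_def)
    moreover have "\<mu> * (a * (norm u)\<^sup>2) = norm Q0 * (norm u)\<^sup>2 + (norm u)\<^sup>2"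
      using a(1) by (simp add: \<mu>_def field_simps)
    moreover have "(norm u)\<^sup>2 > 0"
      using that by simp
    ultimately show ?thesis
      using abs_quad_form_le[of Q0 u] unfolding quad_form_linear by linarith
  qed
  then show ?thesis
    using that[of \<mu> w] pA \<open>w \<noteq> 0\<close> by (simp add: pos_definite_def)
qed

theorem theorem3p12:
  fixes Q A Q' A' :: "real \<Rightarrow> real^'n^'n" and \<tau> :: real
  assumes "\<tau> > 0"
    and "has_C1_derivative_on Q Q' 0 \<tau>"
    and "has_C1_derivative_on A A' 0 \<tau>"
    and "\<And>t. t \<in> {0..\<tau>} \<Longrightarrow> transpose (Q t) = Q t"
    and "\<And>t. t \<in> {0..\<tau>} \<Longrightarrow> transpose (A t) = A t"
    and "(pos_definite (Q 0) \<and> (\<exists>u. quad_form (A 0) u > 0)) \<or> pos_definite (A 0)"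
  shows "(\<exists>\<delta>\<in>{0<..\<tau>}. \<forall>t\<in>{0..\<delta>}. inf_finite_attained Q A t) \<and>
    (\<exists>dg. has_right_derivative (g_inf Q A) dg 0 \<and>
      (\<exists>u0\<in>X_set Q A 0. \<exists>p0.
         bdd_below (quad_form (Q' 0 + p0 *\<^sub>R A' 0) ` X_set Q A 0) \<and>
         dg = (INF u\<in>X_set Q A 0. quad_form (Q' 0 + p0 *\<^sub>R A' 0) u) \<and>
         dg = quad_form (Q' 0 + p0 *\<^sub>R A' 0) u0 \<and>
         Q 0 *v u0 + p0 *\<^sub>R (A 0 *v u0) = 0 \<and>
         p0 = - quad_form (Q 0) u0 \<and>
         quad_form (A 0) u0 = 1))"
proof -
  note tau = assms(1)
  note Q = C1_tendsto_at_right[OF tau assms(2)] and A = C1_tendsto_at_right[OF tau assms(3)]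
  obtain \<mu> w where pd: "pos_definite (Q 0 + \<mu> *\<^sub>R A 0)" and w: "quad_form (A 0) w > 0"
    using exists_positive_definite_combination[OF assms(6)] by blast
  obtain C where C: "C > 0" "\<And>u. C * (norm u)\<^sup>2 \<le> quad_form (Q 0 + \<mu> *\<^sub>R A 0) u"
    using pos_definite_coercive[OF pd] by blast
  define c where "c = C / 2"
  have c: "c > 0"
    using C by (simp add: c_def)
  have coercive0: "c * (norm u)\<^sup>2 \<le> quad_form (Q 0 + \<mu> *\<^sub>R A 0) u" for u
    using C(2)[of u] C(1) by (smt (verit) c_def field_sum_of_halves mult_right_mono zero_le_power2)
  have coercive: "\<forall>\<^sub>F t in at_right 0. \<forall>u. c * (norm u)\<^sup>2 \<le> quad_form (Q t + \<mu> *\<^sub>R A t) u"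
    unfolding c_def by (intro coercive_eventually[OF _ C] tendsto_intros Q(1) A(1))
  have Aw: "\<forall>\<^sub>F t in at_right 0. quad_form (A t) w > 0"
    by (rule order_tendstoD(1)[OF tendsto_quad_form[OF A(1) tendsto_const] w])
  have att: "\<forall>\<^sub>F t in at_right 0. inf_finite_attained Q A t"
    using coercive Aw by eventually_elim (use c coercive_imp_attained in blast)
  have att0: "inf_finite_attained Q A 0"
    using coercive_imp_attained[where Q = Q and A = A, OF c coercive0 w] .

  have "\<exists>\<delta>\<in>{0<..\<tau>}. \<forall>t\<in>{0..\<delta>}. inf_finite_attained Q A t"
  proof -
    obtain b where b: "b > 0" "\<And>t. 0 < t \<Longrightarrow> t < b \<Longrightarrow> inf_finite_attained Q A t"
      using att by (auto simp: eventually_at_right_field)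
    have "inf_finite_attained Q A t" if "t \<in> {0..min \<tau> (b / 2)}" for t
      using that b att0 by (cases "t = 0") auto
    then show ?thesis
      using tau b(1) by (intro bexI[of _ "min \<tau> (b / 2)"]) auto
  qed
  moreover
  define M0 where "M0 = Q' 0 - g_inf Q A 0 *\<^sub>R A' 0"
  have ne: "X_set Q A 0 \<noteq> {}"
    using att0 by (simp add: inf_finite_attained_def)
  obtain u0 where u0: "u0 \<in> X_set Q A 0" "\<And>u. u \<in> X_set Q A 0 \<Longrightarrow> quad_form M0 u0 \<le> quad_form M0 u"
    using continuous_attains_inf[OF compact_X_set[where Q = Q and A = A, OF c coercive0] ne continuous_on_quad_form]
    by blast
  have "has_right_derivative (g_inf Q A) (quad_form M0 u0) 0"
    using g_inf_right_derivative[OF Q(1) A(1) Q(2) A(2) att0 att c coercive0 coercive u0(1)] u0(2)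
    by (simp add: M0_def)
  moreover have "bdd_below (quad_form M0 ` X_set Q A 0)"
    using u0(2) by (intro bdd_belowI2)
  moreover have "quad_form M0 u0 = (INF u\<in>X_set Q A 0. quad_form M0 u)"
    using u0 by (intro cInf_eq_minimum[symmetric]) auto
  moreover have "Q 0 *v u0 - g_inf Q A 0 *\<^sub>R (A 0 *v u0) = 0"
  proof (rule X_set_multiplier_equation[OF att0 _ _ _ u0(1)])
    show "quad_form (Q 0 + \<mu> *\<^sub>R A 0) u \<ge> 0" for u
      using coercive0[of u] c by (smt (verit) mult_nonneg_nonneg zero_le_power2)
  qed (use assms(4,5) tau in auto)
  moreover have "quad_form (A 0) u0 = 1" "quad_form (Q 0) u0 = g_inf Q A 0"
    using u0(1) by (auto simp: X_set_def E_set_def)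
  moreover have "Q' 0 + (- g_inf Q A 0) *\<^sub>R A' 0 = M0"
    by (simp add: M0_def)
  ultimately show ?thesis
    using u0(1) by (intro conjI exI[of _ "quad_form M0 u0"] bexI[of _ u0]
        exI[of _ "- g_inf Q A 0"]) simp_all
qed

end
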